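(* Let $\sigma$ be an ordinary parallel chip-firing game on a finite connected undirected graph $G$. Then for every vertex $v\in V(G)$, the periodic firing pattern of $v$ in $\sigma$ is not clumpy.
   Context: All graphs are finite, undirected, simple and connected; $N(v)$ is the set of neighbors of $v$, $d(v)=\#N(v)$, and $\mathbb{N}=\{0,1,2,\dots\}$. An (ordinary) parallel chip-firing game $\sigma$ on $G$ is a sequence $(\sigma_t)_{t\in\mathbb N}$ of positions $\sigma_t\colon V(G)\to\mathbb N$ ($\sigma_t(v)$ is the number of chips on $v$ at time $t$) such that, with $F_t(v)=1$ if $\sigma_t(v)\ge d(v)$ ($v$ fires at $t$) and $F_t(v)=0$ if $\sigma_t(v)\le d(v)-1$ ($v$ waits at $t$), $$\sigma_{t+1}(v)=\sigma_t(v)+\sum_{w\in N(v)}F_t(w)-F_t(v)\,d(v)\qquad\text{for all }v\in V(G),\ t\in\mathbb N.$$ A position $\sigma_t$ is periodic if $\sigma_t=\sigma_{t+p}$ for some integer $p>0$; the minimum such $p$ is the period $P$ of $\sigma$ (it does not depend on the choice of periodic $\sigma_t$). Every game is eventually periodic. Let $t_0$ be the smallest natural number such that $\sigma_{t_0}$ is periodic. The periodic firing pattern (PFP) of $v$ is the binary string $F_{t_0}(v)F_{t_0+1}(v)\cdots F_{t_0+P-1}(v)$, regarded cyclically (indices modulo $P$). A PFP is clumpy if it contains, cyclically, both two consecutive 0s and two consecutive 1s (so, for example, $011010$ is clumpy, its last and first entries being consecutive). *)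

theory Defs
  imports "Graph_Theory.Digraph_Component"
begin

text \<open>
  A finite simple undirected graph is a \<^locale>\<open>graph\<close>: a finite symmetric digraph
  without loops or parallel arcs.  A position is a function on the whole vertex type, but only
  its values on \<^term>\<open>verts G\<close> are ever used.
\<close>

definition neighbors :: "('a, 'b) pre_digraph \<Rightarrow> 'a \<Rightarrow> 'a set" where
  "neighbors G v = {w. v \<rightarrow>\<^bsub>G\<^esub> w}"

definition deg :: "('a, 'b) pre_digraph \<Rightarrow> 'a \<Rightarrow> nat" where
  "deg G v = card (neighbors G v)"

definition fires :: "('a, 'b) pre_digraph \<Rightarrow> (nat \<Rightarrow> 'a \<Rightarrow> nat) \<Rightarrow> nat \<Rightarrow> 'a \<Rightarrow> nat" where
  "fires G \<sigma> t v = (if \<sigma> t v \<ge> deg G v then 1 else 0)"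

text \<open>The update rule is stated over the integers to avoid truncated subtraction.\<close>

definition chip_firing_game :: "('a, 'b) pre_digraph \<Rightarrow> (nat \<Rightarrow> 'a \<Rightarrow> nat) \<Rightarrow> bool" where
  "chip_firing_game G \<sigma> \<longleftrightarrow>
     (\<forall>t. \<forall>v \<in> verts G.
        int (\<sigma> (t + 1) v) =
          int (\<sigma> t v) + (\<Sum>w \<in> neighbors G v. int (fires G \<sigma> t w))
            - int (fires G \<sigma> t v) * int (deg G v))"

definition returns_after ::
    "('a, 'b) pre_digraph \<Rightarrow> (nat \<Rightarrow> 'a \<Rightarrow> nat) \<Rightarrow> nat \<Rightarrow> nat \<Rightarrow> bool" where
  "returns_after G \<sigma> t p \<longleftrightarrow> p > 0 \<and> (\<forall>v \<in> verts G. \<sigma> t v = \<sigma> (t + p) v)"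

definition periodic_position ::
    "('a, 'b) pre_digraph \<Rightarrow> (nat \<Rightarrow> 'a \<Rightarrow> nat) \<Rightarrow> nat \<Rightarrow> bool" where
  "periodic_position G \<sigma> t \<longleftrightarrow> (\<exists>p. returns_after G \<sigma> t p)"

definition first_periodic :: "('a, 'b) pre_digraph \<Rightarrow> (nat \<Rightarrow> 'a \<Rightarrow> nat) \<Rightarrow> nat" where
  "first_periodic G \<sigma> = (LEAST t. periodic_position G \<sigma> t)"

text \<open>
  The minimal return time is the same for all periodic positions of a game, so it may be read
  off at the first one.  Both least elements exist because every game on a finite graph is
  eventually periodic.
\<close>

definition period :: "('a, 'b) pre_digraph \<Rightarrow> (nat \<Rightarrow> 'a \<Rightarrow> nat) \<Rightarrow> nat" where
  "period G \<sigma> = (LEAST p. returns_after G \<sigma> (first_periodic G \<sigma>) p)"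

definition periodic_firing_pattern ::
    "('a, 'b) pre_digraph \<Rightarrow> (nat \<Rightarrow> 'a \<Rightarrow> nat) \<Rightarrow> 'a \<Rightarrow> nat list" where
  "periodic_firing_pattern G \<sigma> v =
     map (\<lambda>i. fires G \<sigma> (first_periodic G \<sigma> + i) v) [0..<period G \<sigma>]"

definition cyclically_repeats :: "nat \<Rightarrow> nat list \<Rightarrow> bool" where
  "cyclically_repeats b xs \<longleftrightarrow>
     (\<exists>i < length xs. xs ! i = b \<and> xs ! ((i + 1) mod length xs) = b)"

definition clumpy :: "nat list \<Rightarrow> bool" where
  "clumpy xs \<longleftrightarrow> cyclically_repeats 0 xs \<and> cyclically_repeats 1 xs"

lemma "clumpy [0, 1, 1, 0, 1, 0]"
proof -
  have "cyclically_repeats 0 [0, 1, 1, 0, 1, 0]"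
    unfolding cyclically_repeats_def by (rule exI[of _ 5]) simp
  moreover have "cyclically_repeats 1 [0, 1, 1, 0, 1, 0]"
    unfolding cyclically_repeats_def by (rule exI[of _ 1]) simp
  ultimately show ?thesis
    by (simp add: clumpy_def)
qed

end

theory Submission
  imports Defs
begin

text \<open>
  Let $f$ be the periodic $0$-$1$ firing sequence of a vertex, $U_t$ the number of firings
  before time $t$, and suppose that at least half of the entries are $1$.  The walk
  $Y_t = U_t + U_{t+1} - t$ goes up at each $11$, down at each $00$ and is constant
  in between; let $h_t \<ge> 0$ be its excess over its future minimum $m_t$.

  Neighbors fire equally often in a period, and for two sequences $f, g$ with equally many
  firings $\sum_t (f_t - g_t)(h^f_t - h^g_t) \<le> 0$.  Here $h_t = D_t + D_{t+1}$ for some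
  $D_t \<ge> 0$ that vanishes where $m$ jumps, so summation by parts turns the sum into
  $-\sum_t (D^g_{t+1} \Delta m^f_t + D^f_{t+1} \Delta m^g_t)$.

  Put $s_t(v) = \sigma_t(v) - d(v)$, whose sign decides whether $v$ fires.  By parts,
  $\sum_v \sum_t s_{t+1}(v) (h_{t+1}(v) - h_t(v))$ is half the sum of the above quantity over
  the ordered pairs of neighbors, hence at most $0$.  But each of its terms is nonnegative, and
  positive where $v$ waits at $t$ and at $t + 1$.  So there is no $00$; if at most half of the
  entries are $1$, exchanging the roles of $0$ and $1$ shows that there is no $11$.
\<close>

section \<open>Periodic binary sequences\<close>

definition fired :: "(nat \<Rightarrow> int) \<Rightarrow> nat \<Rightarrow> int" where
  "fired f t = (\<Sum>i<t. f i)"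

definition walk :: "(nat \<Rightarrow> int) \<Rightarrow> nat \<Rightarrow> int" where
  "walk f t = fired f t + fired f (Suc t) - int t"

text \<open>When the walk does not lose over a period, a window of length \<open>P\<close> attains
  the minimum over the whole future.\<close>

definition future_min :: "nat \<Rightarrow> (nat \<Rightarrow> int) \<Rightarrow> nat \<Rightarrow> int" where
  "future_min P f t = Min (walk f ` {t..<t + P})"

definition excess :: "nat \<Rightarrow> (nat \<Rightarrow> int) \<Rightarrow> nat \<Rightarrow> int" where
  "excess P f t = walk f t - future_min P f t"

text \<open>
  The lead of \<^term>\<open>f\<close> over the sequence obtained by flipping \<^term>\<open>f\<close> wherever the
  excess is odd; the walk of that flipped sequence is the future minimum of the walk of
  \<^term>\<open>f\<close> (see \<open>future_min_eq\<close>).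
\<close>

definition lead :: "nat \<Rightarrow> (nat \<Rightarrow> int) \<Rightarrow> nat \<Rightarrow> int" where
  "lead P f t = (excess P f t + 1 - f t) div 2"

lemma fired_Suc: "fired f (Suc t) = fired f t + f t"
  by (simp add: fired_def)

locale dense_periodic =
  fixes P :: nat and f :: "nat \<Rightarrow> int"
  assumes P_pos: "P > 0"
    and binary: "f t = 0 \<or> f t = 1"
    and periodic: "f (t + P) = f t"
    and dense: "int P \<le> 2 * fired f P"
begin

lemma fired_add_period: "fired f (t + P) = fired f t + fired f P"
  by (induction t) (simp_all add: fired_Suc periodic, simp add: fired_def)

lemma walk_add_period: "walk f (t + P) = walk f t + (2 * fired f P - int P)"
  using fired_add_period[of t] fired_add_period[of "Suc t"] by (simp add: walk_def)

lemma walk_Suc: "walk f (Suc t) = walk f t + f t + f (Suc t) - 1"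
  by (simp add: walk_def fired_Suc)

lemma future_min_le: "future_min P f t \<le> walk f t"
  using P_pos by (auto simp: future_min_def intro!: Min_le)

lemma future_min_step: "future_min P f t = min (walk f t) (future_min P f (Suc t))"
proof -
  have P: "{t..<t + P} = insert t {Suc t..<t + P}"
      "{Suc t..<Suc t + P} = insert (t + P) {Suc t..<t + P}"
    using P_pos by auto
  \<comment> \<open>The entry joining the window is no lower than the one leaving it, so adding it
    beside \<open>walk f t\<close> cannot change the minimum.\<close>
  have "walk f t \<le> walk f (t + P)"
    using walk_add_period dense by simp
  then show ?thesis
    unfolding future_min_def P image_insert
    by (cases "{Suc t..<t + P} = {}") (auto simp: Min_insert)
qed

lemma future_min_add_period:
  "future_min P f (t + P) = future_min P f t + (2 * fired f P - int P)"
proof -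
  have shift: "walk f ` {t + P..<t + P + P} = (\<lambda>x. x + (2 * fired f P - int P)) ` walk f ` {t..<t + P}"
    unfolding image_image walk_add_period[symmetric]
    by (metis image_add_atLeastLessThan' image_image)
  have "mono (\<lambda>x. x + (2 * fired f P - int P))"
    by (simp add: mono_def)
  then show ?thesis
    using P_pos unfolding future_min_def shift by (subst mono_Min_commute[symmetric]) auto
qed

lemma excess_nonneg: "excess P f t \<ge> 0"
  using future_min_le by (simp add: excess_def)

lemma excess_add_period: "excess P f (t + P) = excess P f t"
  by (simp add: excess_def walk_add_period future_min_add_period)

text \<open>If the minimum rises, it was attained at \<open>t\<close>, and the walk must stay above
  it afterwards. Since the walk climbs by at most 1, this forces a 11 and a zero excess at both
  ends.\<close>

lemma future_min_cases:
  obtains (flat) "future_min P f (Suc t) = future_min P f t"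
  | (jump) "future_min P f (Suc t) = future_min P f t + 1"
      "f t = 1" "f (Suc t) = 1" "excess P f t = 0" "excess P f (Suc t) = 0"
proof (cases "future_min P f (Suc t) = future_min P f t")
  case True
  then show ?thesis by (rule flat)
next
  case False
  then show ?thesis
    using future_min_step[of t] future_min_le[of "Suc t"] walk_Suc[of t] binary[of t]
      binary[of "Suc t"]
    by (intro jump) (auto simp: excess_def min_def split: if_splits)
qed

lemma excess_Suc:
  "excess P f (Suc t) = excess P f t + f t + f (Suc t) - 1
    - (future_min P f (Suc t) - future_min P f t)"
  by (simp add: excess_def walk_Suc)

lemma lead_nonneg: "lead P f t \<ge> 0"
  using excess_nonneg[of t] binary[of t] by (auto simp: lead_def)

lemma lead_add_period: "lead P f (t + P) = lead P f t"
  by (simp add: lead_def excess_add_period periodic)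

text \<open>On a flat step the two leads are \<open>(e + 1 - f t) div 2\<close> and
  \<open>(e + f t) div 2\<close> with \<open>e = excess P f t\<close>, which are the two rounded
  halves of \<open>e\<close>.\<close>

lemma lead_add_lead: "lead P f t + lead P f (Suc t) = excess P f t"
proof (cases rule: future_min_cases[of t])
  case flat
  then show ?thesis
    using excess_Suc[of t] binary[of t] by (auto simp: lead_def)
next
  case jump
  then show ?thesis by (simp add: lead_def)
qed

lemma future_min_mono: "future_min P f t \<le> future_min P f (Suc t)"
  by (cases rule: future_min_cases[of t]) auto

lemma lead_mult_jump: "lead P f (Suc t) * (future_min P f (Suc t) - future_min P f t) = 0"
  by (cases rule: future_min_cases[of t]) (auto simp: lead_def)

lemma future_min_eq: "future_min P f t = (fired f t - lead P f t)
    + (fired f (Suc t) - lead P f (Suc t)) - int t"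
  using lead_add_lead[of t] by (simp add: excess_def walk_def)

end

section \<open>Comparison of two sequences with equal firing counts\<close>

lemma excess_antitone:
  assumes "dense_periodic P f" and "dense_periodic P g" and "fired f P = fired g P"
  shows "(\<Sum>t<P. (f t - g t) * (excess P f t - excess P g t)) \<le> 0"
proof -
  interpret f: dense_periodic P f by fact
  interpret g: dense_periodic P g by fact
  define \<delta> where "\<delta> t = lead P f t - lead P g t" for t
  define w where "w t = fired f t - fired g t - \<delta> t" for t
  \<comment> \<open>\<open>A\<close> is the boundary term of the summation by parts; it telescopes
    to 0 over a period.\<close>
  define A where "A t = \<delta> t * \<delta> t - \<delta> t * (w (Suc t) - w t)" for t
  have w_period: "w (t + P) = w t" for t
    using assms(3) by (simp add: w_def \<delta>_def f.fired_add_period g.fired_add_period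
        f.lead_add_period g.lead_add_period)
  have "A P = A 0"
    using w_period[of 0] w_period[of 1] f.lead_add_period[of 0] g.lead_add_period[of 0]
    by (simp add: A_def \<delta>_def)
  moreover have "(f t - g t) * (excess P f t - excess P g t) \<le> A (Suc t) - A t" for t
  proof -
    have fg: "f t - g t = (w (Suc t) + \<delta> (Suc t)) - (w t + \<delta> t)"
      by (simp add: w_def fired_Suc)
    have ex: "excess P f t - excess P g t = \<delta> t + \<delta> (Suc t)"
      by (simp add: \<delta>_def f.lead_add_lead[symmetric] g.lead_add_lead[symmetric])
    let ?mf = "future_min P f (Suc t) - future_min P f t"
    let ?mg = "future_min P g (Suc t) - future_min P g t"
    have jumps: "w (Suc (Suc t)) - w t = ?mf - ?mg"
      using f.future_min_eq[of t] f.future_min_eq[of "Suc t"]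
        g.future_min_eq[of t] g.future_min_eq[of "Suc t"]
      by (simp add: w_def \<delta>_def)
    have "(f t - g t) * (excess P f t - excess P g t)
        = \<delta> (Suc t) * (w (Suc (Suc t)) - w t) + (A (Suc t) - A t)"
      unfolding fg ex A_def by (simp add: algebra_simps)
    \<comment> \<open>Each lead vanishes at its own jumps, so only the cross terms survive, and
      these have a definite sign.\<close>
    moreover have "\<delta> (Suc t) * (?mf - ?mg) = - (lead P f (Suc t) * ?mg) - lead P g (Suc t) * ?mf"
      using f.lead_mult_jump[of t] g.lead_mult_jump[of t] unfolding \<delta>_def by algebra
    moreover have "0 \<le> lead P f (Suc t) * ?mg" "0 \<le> lead P g (Suc t) * ?mf"
      using f.lead_nonneg g.lead_nonneg f.future_min_mono g.future_min_mono by simp_all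
    ultimately show ?thesis by (simp add: jumps)
  qed
  then have "(\<Sum>t<P. (f t - g t) * (excess P f t - excess P g t)) \<le> (\<Sum>t<P. A (Suc t) - A t)"
    by (intro sum_mono)
  ultimately show ?thesis by (simp add: sum_lessThan_telescope)
qed

section \<open>Periodic games\<close>

locale symmetric_neighborhoods =
  fixes V :: "'a set" and N :: "'a \<Rightarrow> 'a set"
  assumes finite_V: "finite V"
    and N_subset: "v \<in> V \<Longrightarrow> N v \<subseteq> V"
    and N_sym: "v \<in> V \<Longrightarrow> w \<in> N v \<Longrightarrow> v \<in> N w"
begin

lemma sum_swap: "(\<Sum>v\<in>V. \<Sum>w\<in>N v. x v w) = (\<Sum>v\<in>V. \<Sum>w\<in>N v. x w v)"
  for x :: "'a \<Rightarrow> 'a \<Rightarrow> int"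
proof -
  have fin: "v \<in> V \<Longrightarrow> finite (N v)" for v
    using N_subset finite_V by (rule finite_subset)
  have "(\<Sum>(v, w)\<in>Sigma V N. x v w) = (\<Sum>(v, w)\<in>Sigma V N. x w v)"
    by (rule sum.reindex_bij_witness[of _ prod.swap prod.swap])
      (use N_subset N_sym in fastforce)+
  then show ?thesis
    by (simp add: sum.Sigma finite_V fin)
qed

text \<open>Exchanging \<open>v\<close> and \<open>w\<close> and averaging gives this discrete Green
  identity.\<close>

lemma sum_symmetrize:
  fixes a b :: "'a \<Rightarrow> int"
  shows "2 * (\<Sum>v\<in>V. \<Sum>w\<in>N v. (a v - a w) * b v) = (\<Sum>v\<in>V. \<Sum>w\<in>N v. (a v - a w) * (b v - b w))"
proof -
  have "(\<Sum>v\<in>V. \<Sum>w\<in>N v. (a v - a w) * b v) = (\<Sum>v\<in>V. \<Sum>w\<in>N v. (a w - a v) * b w)"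
    by (rule sum_swap)
  moreover have "(\<Sum>v\<in>V. \<Sum>w\<in>N v. (a v - a w) * (b v - b w))
    = (\<Sum>v\<in>V. \<Sum>w\<in>N v. (a v - a w) * b v) + (\<Sum>v\<in>V. \<Sum>w\<in>N v. (a w - a v) * b w)"
    by (simp add: sum.distrib[symmetric] algebra_simps)
  ultimately show ?thesis by simp
qed

end

text \<open>\<open>s\<close> is chips minus degree. \<open>V\<close> may be any neighbor-closed set
  of vertices, and negative \<open>s\<close> is unrestricted, so subgames and complements are again
  instances.\<close>

locale periodic_game = symmetric_neighborhoods V N
  for V :: "'a set" and N +
  fixes P :: nat and F :: "'a \<Rightarrow> nat \<Rightarrow> int" and s :: "'a \<Rightarrow> nat \<Rightarrow> int"
  assumes period_pos: "P > 0"
    and s_period: "v \<in> V \<Longrightarrow> s v (t + P) = s v t"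
    and F_eq: "v \<in> V \<Longrightarrow> F v t = (if s v t \<ge> 0 then 1 else 0)"
    and s_step: "v \<in> V \<Longrightarrow> s v (Suc t) = s v t + (\<Sum>w\<in>N v. F w t - F v t)"
begin

lemma s_sum: "v \<in> V \<Longrightarrow> s v t = s v 0 + (\<Sum>w\<in>N v. fired (F w) t - fired (F v) t)"
proof (induction t)
  case 0
  then show ?case by (simp add: fired_def)
next
  case (Suc t)
  then show ?case
    by (simp add: s_step fired_Suc sum.distrib[symmetric] algebra_simps)
qed

text \<open>No net gain over a period makes the firing count harmonic, so its Dirichlet energy
  vanishes.\<close>

lemma fired_neighbor_eq:
  assumes "v \<in> V" and "w \<in> N v"
  shows "fired (F w) P = fired (F v) P"
proof -
  define k where "k v = fired (F v) P" for v
  have fin: "finite (N v)" if "v \<in> V" for v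
    using that N_subset finite_V by (meson finite_subset)
  have "(\<Sum>w\<in>N v. (k v - k w) * k v) = 0" if "v \<in> V" for v
  proof -
    have "(\<Sum>w\<in>N v. k w - k v) = 0"
      using s_sum[OF that, of P] s_period[OF that, of 0] by (simp add: k_def)
    then have "(\<Sum>w\<in>N v. k v - k w) = 0"
      by (simp add: sum_subtractf)
    then show ?thesis by (simp add: sum_distrib_right[symmetric])
  qed
  then have "(\<Sum>v\<in>V. \<Sum>w\<in>N v. (k v - k w) * (k v - k w)) = 0"
    unfolding sum_symmetrize[symmetric] by simp
  then have "\<forall>v\<in>V. (\<Sum>w\<in>N v. (k v - k w) * (k v - k w)) = 0"
    by (subst (asm) sum_nonneg_eq_0_iff) (auto simp: finite_V intro!: sum_nonneg)
  then have "(\<Sum>w\<in>N v. (k v - k w) * (k v - k w)) = 0"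
    using assms(1) by blast
  then have "(k v - k w) * (k v - k w) = 0"
    using assms fin by (subst (asm) sum_nonneg_eq_0_iff) auto
  then show ?thesis by (simp add: k_def)
qed

lemma no_double_wait_uniform:
  assumes same: "\<And>v. v \<in> V \<Longrightarrow> fired (F v) P = k"
    and dense: "int P \<le> 2 * k"
    and v: "v \<in> V" and t: "t < P"
  shows "\<not> (F v t = 0 \<and> F v (Suc t) = 0)"
proof
  assume wait: "F v t = 0 \<and> F v (Suc t) = 0"
  define h where "h v = excess P (F v)" for v
  have dp: "dense_periodic P (F v)" if "v \<in> V" for v
    using that period_pos s_period same dense by unfold_locales (auto simp: F_eq)
  define T where "T v t = s v (Suc t) * (h v (Suc t) - h v t)" for v t
  \<comment> \<open>The excess cannot fall when \<open>v\<close> fires at \<open>Suc t\<close> and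
    cannot rise when it waits there; after a 00 it drops by 1 while \<open>s\<close> is
    negative.\<close>
  have T_nonneg: "0 \<le> T v t" and T_pos: "F v t = 0 \<and> F v (Suc t) = 0 \<longrightarrow> 0 < T v t"
    if "v \<in> V" for v t
  proof -
    interpret dense_periodic P "F v" using that by (rule dp)
    show "0 \<le> T v t" "F v t = 0 \<and> F v (Suc t) = 0 \<longrightarrow> 0 < T v t"
      using excess_Suc[of t] binary[of t] F_eq[OF that, of "Suc t"]
      by (cases rule: future_min_cases[of t];
          auto simp: T_def h_def mult_nonpos_nonpos split: if_splits)+
  qed
  have by_parts: "(\<Sum>t<P. T v t) = (\<Sum>w\<in>N v. \<Sum>t<P. (F v t - F w t) * h v t)"
    if "v \<in> V" for v
  proof -
    interpret dense_periodic P "F v" using that by (rule dp)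
    have "T v t = (s v (Suc t) * h v (Suc t) - s v t * h v t)
        + (\<Sum>w\<in>N v. (F v t - F w t) * h v t)" for t
      by (simp add: T_def s_step[OF that] sum_distrib_right[symmetric] sum_subtractf
          algebra_simps)
    then have "(\<Sum>t<P. T v t) = (s v P * h v P - s v 0 * h v 0)
        + (\<Sum>t<P. \<Sum>w\<in>N v. (F v t - F w t) * h v t)"
      by (simp add: sum.distrib sum_lessThan_telescope[of "\<lambda>t. s v t * h v t"])
    moreover have "s v P = s v 0" "h v P = h v 0"
      using s_period[OF that, of 0] excess_add_period[of 0] by (simp_all add: h_def)
    ultimately show ?thesis by (subst sum.swap) simp
  qed
  \<comment> \<open>Both orders of summation occur: \<open>sum_symmetrize\<close> works at a fixed
    time, \<open>excess_antitone\<close> on a fixed pair.\<close>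
  have time_out: "(\<Sum>v\<in>V. \<Sum>w\<in>N v. \<Sum>t<P. x v w t) = (\<Sum>t<P. \<Sum>v\<in>V. \<Sum>w\<in>N v. x v w t)"
    for x :: "'a \<Rightarrow> 'a \<Rightarrow> nat \<Rightarrow> int"
  proof -
    have "(\<Sum>v\<in>V. \<Sum>w\<in>N v. \<Sum>t<P. x v w t) = (\<Sum>v\<in>V. \<Sum>t<P. \<Sum>w\<in>N v. x v w t)"
      by (intro sum.cong refl sum.swap)
    also have "\<dots> = (\<Sum>t<P. \<Sum>v\<in>V. \<Sum>w\<in>N v. x v w t)"
      by (rule sum.swap)
    finally show ?thesis .
  qed
  have "2 * (\<Sum>v\<in>V. \<Sum>t<P. T v t)
      = (\<Sum>t<P. 2 * (\<Sum>v\<in>V. \<Sum>w\<in>N v. (F v t - F w t) * h v t))"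
    by (simp only: by_parts time_out sum_distrib_left cong: sum.cong)
  also have "\<dots> = (\<Sum>v\<in>V. \<Sum>w\<in>N v. \<Sum>t<P. (F v t - F w t) * (h v t - h w t))"
    unfolding sum_symmetrize time_out ..
  also have "\<dots> \<le> 0"
    unfolding h_def using N_subset same
    by (intro sum_nonpos excess_antitone dp) (auto dest: subsetD)
  finally have "(\<Sum>v\<in>V. \<Sum>t<P. T v t) \<le> 0" by simp
  moreover have "0 < (\<Sum>t<P. T v t)"
    using T_nonneg[OF v] T_pos[OF v, of t] wait t by (intro sum_pos2[of _ t]) auto
  then have "0 < (\<Sum>v\<in>V. \<Sum>t<P. T v t)"
    using T_nonneg v finite_V by (intro sum_pos2[of _ v] sum_nonneg) auto
  ultimately show False by simp
qed

lemma no_double_wait: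
  assumes v: "v \<in> V" and dense: "int P \<le> 2 * fired (F v) P" and t: "t < P"
  shows "\<not> (F v t = 0 \<and> F v (Suc t) = 0)"
proof -
  \<comment> \<open>By \<open>fired_neighbor_eq\<close> this set is closed under neighbors, and all
    its vertices fire equally often.\<close>
  interpret sub: periodic_game "{u \<in> V. fired (F u) P = fired (F v) P}" N P F s
    using finite_V N_subset N_sym fired_neighbor_eq period_pos s_period F_eq s_step
    by unfold_locales (auto dest: subsetD)
  show ?thesis
    using sub.no_double_wait_uniform[OF _ dense _ t] v by simp
qed

text \<open>The shift by 1 turns \<open>s < 0\<close> into \<open>- s - 1 \<ge> 0\<close>, so
  waiting and firing change places.\<close>

lemma complement: "periodic_game V N P (\<lambda>v t. 1 - F v t) (\<lambda>v t. - s v t - 1)"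
  using period_pos s_period
  by unfold_locales (auto simp: F_eq s_step sum_subtractf)

lemma no_double_wait_or_no_double_fire:
  assumes v: "v \<in> V"
  shows "(\<forall>t<P. \<not> (F v t = 0 \<and> F v (Suc t) = 0)) \<or> (\<forall>t<P. \<not> (F v t = 1 \<and> F v (Suc t) = 1))"
proof (cases "int P \<le> 2 * fired (F v) P")
  case True
  then show ?thesis using no_double_wait[OF v] by blast
next
  case False
  interpret c: periodic_game V N P "\<lambda>v t. 1 - F v t" "\<lambda>v t. - s v t - 1"
    by (rule complement)
  have "fired (\<lambda>t. 1 - F v t) P = int P - fired (F v) P"
    by (simp add: fired_def sum_subtractf)
  with False show ?thesis using c.no_double_wait[OF v] by auto
qed

end

section \<open>Games on graphs\<close>

locale game_on_graph = graph G
  for G :: "('a, 'b) pre_digraph" +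
  fixes \<sigma> :: "nat \<Rightarrow> 'a \<Rightarrow> nat"
  assumes game: "chip_firing_game G \<sigma>"

sublocale game_on_graph \<subseteq> symmetric_neighborhoods "verts G" "neighbors G"
  by unfold_locales (auto simp: neighbors_def adj_in_verts intro: graph_symmetric)

context game_on_graph
begin

lemma step: "v \<in> verts G \<Longrightarrow> int (\<sigma> (Suc t) v) = int (\<sigma> t v)
    + (\<Sum>w\<in>neighbors G v. int (fires G \<sigma> t w) - int (fires G \<sigma> t v))"
  using game by (simp add: chip_firing_game_def sum_subtractf deg_def)

section \<open>Conservation of chips and eventual periodicity\<close>

lemma total_chips: "(\<Sum>v\<in>verts G. int (\<sigma> t v)) = (\<Sum>v\<in>verts G. int (\<sigma> 0 v))"
proof (induction t)
  case (Suc t)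
  have "(\<Sum>v\<in>verts G. \<Sum>w\<in>neighbors G v. int (fires G \<sigma> t w) - int (fires G \<sigma> t v)) = 0"
    using sum_swap[of "\<lambda>v w. int (fires G \<sigma> t w)"] by (simp add: sum_subtractf)
  then show ?case by (simp add: step sum.distrib Suc)
qed simp

lemma ex_periodic_position: "\<exists>t. periodic_position G \<sigma> t"
proof -
  define C where "C = nat (\<Sum>v\<in>verts G. int (\<sigma> 0 v))"
  \<comment> \<open>Restriction discards values outside \<open>verts G\<close>, leaving finitely
    many positions for the pigeonhole argument.\<close>
  define r where "r t = restrict (\<sigma> t) (verts G)" for t
  have "\<sigma> t v \<le> C" if "v \<in> verts G" for t v
  proof -
    have "int (\<sigma> t v) \<le> (\<Sum>v\<in>verts G. int (\<sigma> t v))"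
      using that by (intro member_le_sum) auto
    then show ?thesis by (simp add: C_def total_chips[of t])
  qed
  then have "range r \<subseteq> verts G \<rightarrow>\<^sub>E {..C}"
    by (auto simp: r_def)
  then have "finite (range r)"
    by (rule finite_subset) (simp add: finite_PiE)
  then have "\<not> inj r"
    using finite_imageD by blast
  then obtain t u where "r t = r u" "t < u"
    unfolding inj_def by (metis linorder_neqE_nat)
  then have "returns_after G \<sigma> t (u - t)"
    by (auto simp: returns_after_def r_def) (metis restrict_apply')
  then show ?thesis by (auto simp: periodic_position_def)
qed

lemma returns_period: "returns_after G \<sigma> (first_periodic G \<sigma>) (period G \<sigma>)"
proof -
  have "periodic_position G \<sigma> (first_periodic G \<sigma>)"
    unfolding first_periodic_def using ex_periodic_position by (rule LeastI_ex)
  then show ?thesis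
    unfolding periodic_position_def period_def by (rule LeastI_ex)
qed

lemma position_periodic:
  assumes "returns_after G \<sigma> t p" and "v \<in> verts G"
  shows "\<sigma> (t + i + p) v = \<sigma> (t + i) v"
  using assms(2)
proof (induction i arbitrary: v)
  case 0
  then show ?case using assms(1) by (simp add: returns_after_def)
next
  case (Suc i)
  have "fires G \<sigma> (t + i + p) w = fires G \<sigma> (t + i) w" if "w \<in> verts G" for w
    using Suc.IH[OF that] by (simp add: fires_def)
  then have "int (\<sigma> (Suc (t + i + p)) v) = int (\<sigma> (Suc (t + i)) v)"
    unfolding step[OF Suc.prems] using Suc N_subset[OF Suc.prems] by (auto intro!: sum.cong)
  then show ?case by simp
qed

sublocale periodic_game "verts G" "neighbors G" "period G \<sigma>"
  "\<lambda>v t. int (fires G \<sigma> (first_periodic G \<sigma> + t) v)"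
  "\<lambda>v t. int (\<sigma> (first_periodic G \<sigma> + t) v) - int (deg G v)"
proof unfold_locales
  let ?t = "first_periodic G \<sigma>"
  show "0 < period G \<sigma>"
    using returns_period by (simp add: returns_after_def)
  fix v t assume v: "v \<in> verts G"
  show "int (\<sigma> (?t + (t + period G \<sigma>)) v) - int (deg G v) = int (\<sigma> (?t + t) v) - int (deg G v)"
    using position_periodic[OF returns_period v, of t] by (simp add: add.assoc)
  show "int (fires G \<sigma> (?t + t) v) = (if int (\<sigma> (?t + t) v) - int (deg G v) \<ge> 0 then 1 else 0)"
    by (simp add: fires_def)
  show "int (\<sigma> (?t + Suc t) v) - int (deg G v) = int (\<sigma> (?t + t) v) - int (deg G v)
      + (\<Sum>w\<in>neighbors G v. int (fires G \<sigma> (?t + t) w) - int (fires G \<sigma> (?t + t) v))"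
    using step[OF v, of "?t + t"] by simp
qed

lemma cyclically_repeats_pattern:
  assumes v: "v \<in> verts G" and "cyclically_repeats b (periodic_firing_pattern G \<sigma> v)"
  shows "\<exists>i < period G \<sigma>. fires G \<sigma> (first_periodic G \<sigma> + i) v = b
    \<and> fires G \<sigma> (first_periodic G \<sigma> + Suc i) v = b"
proof -
  let ?P = "period G \<sigma>" and ?f = "\<lambda>i. fires G \<sigma> (first_periodic G \<sigma> + i) v"
  obtain i where i: "i < ?P" "?f i = b" "?f (Suc i mod ?P) = b"
    using assms(2) by (auto simp: cyclically_repeats_def periodic_firing_pattern_def)
  have "?f (Suc i mod ?P) = ?f (Suc i)"
  \<comment> \<open>Only the last index wraps around; there periodicity identifies time
    \<open>?P\<close> with time 0.\<close>
  proof (cases "Suc i = ?P")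
    case True
    then show ?thesis
      using position_periodic[OF returns_period v, of 0] by (simp add: fires_def)
  qed (use i in simp)
  with i show ?thesis by auto
qed

end

theorem theorem6p2:
  fixes G :: "('a, 'b) pre_digraph"
    and \<sigma> :: "nat \<Rightarrow> 'a \<Rightarrow> nat"
  assumes "graph G"
    and "connected G"
    and "chip_firing_game G \<sigma>"
  shows "\<forall>v \<in> verts G. \<not> clumpy (periodic_firing_pattern G \<sigma> v)"
proof
  fix v assume v: "v \<in> verts G"
  interpret game_on_graph G \<sigma>
    using assms(1,3) by (simp add: game_on_graph_def game_on_graph_axioms_def)
  show "\<not> clumpy (periodic_firing_pattern G \<sigma> v)"
    using no_double_wait_or_no_double_fire[OF v] cyclically_repeats_pattern[OF v, of 0]
      cyclically_repeats_pattern[OF v, of 1]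
    unfolding clumpy_def by fastforce
qed

end
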